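(* For any prime power $q\geq 3$, the Petersen graph is a subgraph of the Erd\H{o}s-R\'enyi graph $ER_q$.
   Context: The Erd\H{o}s-R\'enyi graph $ER_q$ is the graph whose vertices are the points of the projective plane $PG(2,q)$ (the $1$-dimensional subspaces of $\mathbb{F}_q^3$), in which two distinct points $(x_0,x_1,x_2)$ and $(y_0,y_1,y_2)$ are adjacent if and only if $x_0y_0+x_1y_1+x_2y_2=0$. "Subgraph" means not necessarily induced subgraph. *)

theory Defs
  imports
    "HOL-Analysis.Cartesian_Space"
    "HOL-Number_Theory.Prime_Powers"
    "Graph_Theory.Pair_Digraph"
    "Graph_Theory.Digraph_Isomorphism"
begin

text \<open>
  Finite simple graphs are the \<^locale>\<open>pair_graph\<close>s of the library: every undirected edge
  is represented by its two opposite arcs.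
\<close>

definition petersen_graph :: "nat set pair_pre_digraph" where
  "petersen_graph =
    (let V = {A. A \<subseteq> {0..<5} \<and> card A = 2}
     in \<lparr>pverts = V, parcs = {(A, B). A \<in> V \<and> B \<in> V \<and> A \<inter> B = {}}\<rparr>)"

definition proj_plane_points :: "('a::field ^ 3) set set" where
  "proj_plane_points = {P. vec.subspace P \<and> vec.dim P = 1}"

text \<open>
  The coordinates \<open>x\<^sub>0, x\<^sub>1, x\<^sub>2\<close> are the components of a vector at the indices 1, 2, 3.
\<close>

definition dot3 :: "'a::field ^ 3 \<Rightarrow> 'a ^ 3 \<Rightarrow> 'a" where
  "dot3 x y = x $ 1 * y $ 1 + x $ 2 * y $ 2 + x $ 3 * y $ 3"

text \<open>
  The relation is stated through homogeneous coordinates, that is, nonzero representatives;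
  \<open>erdos_renyi_arc_iff\<close> below shows that their choice does not matter.
\<close>

definition erdos_renyi_graph :: "('a::field ^ 3) set pair_pre_digraph" where
  "erdos_renyi_graph =
    \<lparr>pverts = proj_plane_points,
     parcs = {(P, Q). P \<in> proj_plane_points \<and> Q \<in> proj_plane_points \<and> P \<noteq> Q \<and>
       (\<exists>x\<in>P. \<exists>y\<in>Q. x \<noteq> 0 \<and> y \<noteq> 0 \<and> dot3 x y = 0)}\<rparr>"

lemma span_in_proj_plane_points:
  fixes x :: "'a::field ^ 3"
  assumes "x \<noteq> 0"
  shows "vec.span {x} \<in> proj_plane_points"
proof -
  have "vec.independent {x}" using assms by simp
  then have "vec.dim (vec.span {x}) = 1" using vec.dim_span_eq_card_independent by fastforce
  then show ?thesis by (simp add: proj_plane_points_def)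
qed

lemma proj_plane_point_eq_span:
  fixes P :: "('a::field ^ 3) set"
  assumes "P \<in> proj_plane_points" "x \<in> P" "x \<noteq> 0"
  shows "P = vec.span {x}"
proof -
  have "vec.independent {x}" using assms by simp
  then have "P \<subseteq> vec.span {x}"
    using assms vec.card_ge_dim_independent[of "{x}" P] by (simp add: proj_plane_points_def)
  moreover have "vec.span {x} \<subseteq> P"
    using assms vec.span_minimal[of "{x}" P] by (simp add: proj_plane_points_def)
  ultimately show ?thesis by blast
qed

lemma erdos_renyi_arc_iff:
  fixes x y :: "'a::field ^ 3"
  assumes "x \<noteq> 0" "y \<noteq> 0"
  shows "(vec.span {x}, vec.span {y}) \<in> parcs erdos_renyi_graph
     \<longleftrightarrow> vec.span {x} \<noteq> vec.span {y} \<and> dot3 x y = 0"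
proof -
  have "dot3 x y = 0"
    if uv: "u \<in> vec.span {x}" "v \<in> vec.span {y}" "u \<noteq> 0" "v \<noteq> 0" "dot3 u v = 0" for u v
  proof -
    obtain a b where ab: "u = a *s x" "v = b *s y"
      using uv by (auto simp: vec.span_singleton)
    then have "a \<noteq> 0" "b \<noteq> 0" using uv by auto
    moreover have "dot3 u v = a * b * dot3 x y"
      by (simp add: ab dot3_def algebra_simps)
    ultimately show ?thesis using uv by simp
  qed
  then have "(\<exists>u\<in>vec.span {x}. \<exists>v\<in>vec.span {y}. u \<noteq> 0 \<and> v \<noteq> 0 \<and> dot3 u v = 0)
      \<longleftrightarrow> dot3 x y = 0"
    using assms vec.span_base[of x "{x}"] vec.span_base[of y "{y}"] by blast
  then show ?thesis
    using assms by (simp add: erdos_renyi_graph_def span_in_proj_plane_points)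
qed

lemma pair_graph_petersen: "pair_graph petersen_graph"
proof -
  have V: "finite {A. A \<subseteq> {0..<5::nat} \<and> card A = 2}" by simp
  show ?thesis
    by unfold_locales
      (auto simp: petersen_graph_def symmetric_def sym_def
        intro: finite_subset[OF _ finite_cartesian_product[OF V V]])
qed

lemma pair_graph_erdos_renyi:
  "pair_graph (erdos_renyi_graph :: ('a::{field,finite} ^ 3) set pair_pre_digraph)"
proof -
  have comm: "dot3 x y = dot3 y x" for x y :: "'a ^ 3"
    by (simp add: dot3_def mult.commute)
  have "sym (parcs (erdos_renyi_graph :: ('a ^ 3) set pair_pre_digraph))"
  proof (rule symI)
    fix P Q :: "('a ^ 3) set"
    assume "(P, Q) \<in> parcs erdos_renyi_graph"
    then obtain x y where "P \<in> proj_plane_points" "Q \<in> proj_plane_points" "P \<noteq> Q"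
      "x \<in> P" "y \<in> Q" "x \<noteq> 0" "y \<noteq> 0" "dot3 y x = 0"
      by (auto simp: erdos_renyi_graph_def comm)
    then show "(Q, P) \<in> parcs erdos_renyi_graph"
      unfolding erdos_renyi_graph_def by auto
  qed
  then show ?thesis
    by unfold_locales (simp_all add: symmetric_def, auto simp: erdos_renyi_graph_def)
qed

end

theory Submission
  imports Defs
begin

text \<open>
  In odd characteristic, the ten points with coordinates in \<open>{-1, 0, 1}\<close> and at least two nonzero
  coordinates span a Petersen graph: in \<open>ER\<^sub>3\<close> only the coordinate triangle is left out, and all
  orthogonality relations used hold already over the integers. The field with two elements is too
  small, so in characteristic 2 the coordinates also involve some \<open>t\<close> other than 0 and 1.
\<close>

text \<open>Used contrapositively: one unequal pair of such products shows that two points of the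
  plane differ, which turns distinctness into arithmetic with coordinates.\<close>

lemma minors_eq_if_span_eq:
  fixes x y :: "'a::field ^ 'n"
  assumes "vec.span {x} = vec.span {y}"
  shows "x $ i * y $ j = x $ j * y $ i"
proof -
  have "x \<in> vec.span {y}"
    using assms vec.span_base[of x "{x}"] by simp
  then obtain c where "x = c *s y"
    by (auto simp: vec.span_singleton)
  then show ?thesis
    by simp
qed

lemma exists_3: "(\<exists>i::3. P i) \<longleftrightarrow> P 1 \<or> P 2 \<or> P 3"
  by (metis exhaust_3)

lemma less_five_cases:
  fixes i j :: nat
  assumes "i < j" "j < 5"
  shows "(i, j) \<in> {(0, 1), (0, 2), (0, 3), (0, 4), (1, 2), (1, 3), (1, 4), (2, 3), (2, 4), (3, 4)}"
proof -
  have "j \<in> {1, 2, 3, 4}" "i \<in> {0, 1, 2, 3}"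
    using assms by auto
  then show ?thesis
    using assms(1) by auto
qed

text \<open>Leaves only a table of ten vectors to be checked, where \<open>i < j\<close> names the
  vertex \<open>{i, j}\<close>. Orthogonality is asked only for disjoint pairs because the subgraph
  need not be induced.\<close>

lemma petersen_subgraph_if_points:
  fixes p :: "nat \<Rightarrow> nat \<Rightarrow> 'a::{field,finite} ^ 3"
  assumes nonzero: "\<And>i j. i < j \<Longrightarrow> j < 5 \<Longrightarrow> p i j \<noteq> 0"
    and orth: "\<And>i j k l. i < j \<Longrightarrow> j < 5 \<Longrightarrow> k < l \<Longrightarrow> l < 5 \<Longrightarrow> {i, j} \<inter> {k, l} = {} \<Longrightarrow>
      dot3 (p i j) (p k l) = 0"
    and distinct: "\<And>i j k l. i < j \<Longrightarrow> j < 5 \<Longrightarrow> k < l \<Longrightarrow> l < 5 \<Longrightarrow> (i, j) \<noteq> (k, l) \<Longrightarrow>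
      \<exists>a b. p i j $ a * p k l $ b \<noteq> p i j $ b * p k l $ a"
  shows "\<exists>H. subgraph (with_proj H)
               (with_proj (erdos_renyi_graph :: ('a ^ 3) set pair_pre_digraph))
           \<and> digraph_iso (with_proj petersen_graph) (with_proj H)"
proof -
  define f where "f A = vec.span {p (Min A) (Max A)}" for A
  \<comment> \<open>Taking the image of the Petersen graph makes \<open>f\<close> surjective onto
    \<open>H\<close> by construction; what remains is injectivity and that arcs go to arcs.\<close>
  define H where "H = \<lparr>pverts = f ` pverts petersen_graph,
    parcs = map_prod f f ` parcs petersen_graph\<rparr>"
  let ?G = "erdos_renyi_graph :: ('a ^ 3) set pair_pre_digraph"
  interpret P: pair_graph petersen_graph
    by (rule pair_graph_petersen)
  interpret G: pair_graph ?G
    by (rule pair_graph_erdos_renyi)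
  have f: "f {i, j} = vec.span {p i j}" if "i < j" for i j
    using that by (simp add: f_def)
  have vertE: "\<exists>i j. A = {i, j} \<and> i < j \<and> j < 5" if "A \<in> pverts petersen_graph" for A
  proof -
    have "card A = 2" "A \<subseteq> {0..<5}"
      using that by (simp_all add: petersen_graph_def)
    then obtain i j where "A = {i, j}" "i \<noteq> j" "i < 5" "j < 5"
      by (auto simp: card_2_iff)
    then show ?thesis
      by (metis insert_commute linorder_neqE_nat)
  qed
  have inj: "inj_on f (pverts petersen_graph)"
  proof (rule inj_onI)
    fix A B
    assume "A \<in> pverts petersen_graph" "B \<in> pverts petersen_graph" "f A = f B"
    moreover from this obtain i j k l
      where "A = {i, j}" "i < j" "j < 5" "B = {k, l}" "k < l" "l < 5"
      using vertE by meson
    ultimately show "A = B"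
      using distinct[of i j k l] minors_eq_if_span_eq[of "p i j" "p k l"] by (auto simp: f)
  qed
  have vert: "f A \<in> pverts ?G" if A: "A \<in> pverts petersen_graph" for A
    using vertE[OF A] by (auto simp: f erdos_renyi_graph_def nonzero span_in_proj_plane_points)
  have arc: "(f A, f B) \<in> parcs ?G" if AB: "(A, B) \<in> parcs petersen_graph" for A B
  proof -
    have A: "A \<in> pverts petersen_graph" and B: "B \<in> pverts petersen_graph" and "A \<inter> B = {}"
      using AB by (auto simp: petersen_graph_def)
    then obtain i j k l where ij: "A = {i, j}" "i < j" "j < 5" and kl: "B = {k, l}" "k < l" "l < 5"
      using vertE by meson
    \<comment> \<open>Orthogonality alone gives no arc, since a point may be orthogonal to itself;
      the two image points must also differ.\<close>
    have "A \<noteq> B"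
      using \<open>A \<inter> B = {}\<close> ij by auto
    then have "f A \<noteq> f B"
      using inj A B by (meson inj_onD)
    then show ?thesis
      using erdos_renyi_arc_iff[of "p i j" "p k l"] nonzero orth[of i j k l] ij kl \<open>A \<inter> B = {}\<close>
      by (simp add: f)
  qed
  have "wf_digraph (with_proj H)"
    by unfold_locales (auto simp: H_def petersen_graph_def)
  then have "subgraph (with_proj H) (with_proj ?G)"
    unfolding subgraph_def using vert arc G.wf_digraph_axioms by (auto simp: H_def)
  moreover have "digraph_iso (with_proj petersen_graph) (with_proj H)"
  proof -
    define h where "h = \<lparr>iso_verts = f, iso_arcs = map_prod f f, iso_head = snd, iso_tail = fst\<rparr>"
    have "inj_on (map_prod f f) (parcs petersen_graph)"
      by (rule inj_on_subset[OF map_prod_inj_on[OF inj inj]])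
        (auto simp: petersen_graph_def)
    then have "P.digraph_isomorphism h"
      unfolding P.digraph_isomorphism_def using inj P.wf_digraph_axioms by (simp add: h_def)
    moreover have "with_proj H = app_iso h (with_proj petersen_graph)"
      by (simp add: with_proj_def app_iso_def H_def h_def)
    ultimately show ?thesis
      unfolding digraph_iso_def by blast
  qed
  ultimately show ?thesis
    by blast
qed

theorem theorem1p3:
  fixes q :: nat
  assumes "primepow q" and "q \<ge> 3"
    and "CARD('a::{field,finite}) = q"
  shows "\<exists>H. subgraph (with_proj H)
               (with_proj (erdos_renyi_graph :: ('a ^ 3) set pair_pre_digraph))
           \<and> digraph_iso (with_proj petersen_graph) (with_proj H)"
proof (cases "(2::'a) = 0")
  case False
  \<comment> \<open>Row \<open>i\<close> of the triangular table starts at \<open>j = Suc i\<close>.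
    The four pairs containing 2 get the vectors without a zero coordinate, up to sign. The other six
    get those with exactly one zero, and disjoint pairs among them have it in the same
    place.\<close>
  define p :: "nat \<Rightarrow> nat \<Rightarrow> 'a ^ 3" where
    "p i j = [[vector [0, 1, 1], vector [1, -1, -1], vector [1, -1, 0], vector [1, 0, -1]],
              [vector [1, 1, 1], vector [1, 0, 1], vector [1, 1, 0]],
              [vector [1, -1, 1], vector [1, 1, -1]],
              [vector [0, 1, -1]]] ! i ! (j - Suc i)" for i j
  have neg: "(1::'a) \<noteq> -1" "(-1::'a) \<noteq> 1"
    using False by (metis add.right_inverse one_add_one)+
  show ?thesis
  proof (rule petersen_subgraph_if_points[of p])
    fix i j :: nat
    assume "i < j" "j < 5"
    from less_five_cases[OF this] show "p i j \<noteq> 0"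
      by (auto simp: p_def vec_eq_iff forall_3)
  next
    fix i j k l :: nat
    assume ij: "i < j" "j < 5" and kl: "k < l" "l < 5" and "{i, j} \<inter> {k, l} = {}"
    with less_five_cases[OF ij] less_five_cases[OF kl] show "dot3 (p i j) (p k l) = 0"
      by (elim insertE emptyE) (simp_all add: p_def dot3_def)
  next
    fix i j k l :: nat
    assume ij: "i < j" "j < 5" and kl: "k < l" "l < 5" and "(i, j) \<noteq> (k, l)"
    with less_five_cases[OF ij] less_five_cases[OF kl]
    show "\<exists>a b. p i j $ a * p k l $ b \<noteq> p i j $ b * p k l $ a"
      by (elim insertE emptyE) (simp_all add: p_def exists_3 neg)
  qed
next
  case True
  \<comment> \<open>This is where \<open>q \<ge> 3\<close> enters.\<close>
  have "UNIV \<noteq> {0, 1::'a}"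
  proof
    assume U: "UNIV = {0, 1::'a}"
    show False
      using assms(2) assms(3)[symmetric] by (simp add: U)
  qed
  then obtain t :: 'a where t: "t \<noteq> 0" "t \<noteq> 1"
    by blast
  \<comment> \<open>The second equation lets the simplifier cancel equal summands inside longer sums
    once \<open>add_ac\<close> has made them adjacent.\<close>
  have double: "x + x = 0" "x + (x + y) = y" for x y :: 'a
  proof -
    show xx: "x + x = 0"
      using True by (metis mult_2 mult_zero_left)
    show "x + (x + y) = y"
      by (simp add: add.assoc[symmetric] xx)
  qed
  have t1: "1 + t \<noteq> 0"
    using t(2) double(2)[of 1 t] by (metis add.right_neutral)
  \<comment> \<open>The neighbours of \<open>p 0 1\<close> are three points with third coordinate 0:
    \<open>p 2 3\<close>, \<open>p 2 4\<close> and \<open>p 3 4\<close>. Each of them has two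
    further neighbours, whose first two coordinates it fixes up to scaling. The third coordinates
    are chosen so that these six points close up to the hexagon 02, 13, 04, 12, 03, 14. That
    \<open>1 + t\<close> is nonzero separates, for instance, \<open>p 0 4\<close> from
    \<open>p 0 1\<close>.\<close>
  define p :: "nat \<Rightarrow> nat \<Rightarrow> 'a ^ 3" where
    "p i j = [[vector [0, 0, 1], vector [1, 1, 1], vector [1, t, 1], vector [1 + t, 0, 1]],
              [vector [1, 1, 1 + t], vector [1, t, 1 + t], vector [1, 0, 1]],
              [vector [0, 1, 0], vector [t, 1, 0]],
              [vector [1, 1, 0]]] ! i ! (j - Suc i)" for i j
  show ?thesis
  proof (rule petersen_subgraph_if_points[of p])
    fix i j :: nat
    assume "i < j" "j < 5"
    from less_five_cases[OF this] show "p i j \<noteq> 0"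
      by (auto simp: p_def vec_eq_iff forall_3)
  next
    fix i j k l :: nat
    assume ij: "i < j" "j < 5" and kl: "k < l" "l < 5" and "{i, j} \<inter> {k, l} = {}"
    with less_five_cases[OF ij] less_five_cases[OF kl] show "dot3 (p i j) (p k l) = 0"
      by (elim insertE emptyE) (simp_all add: p_def dot3_def double add_ac)
  next
    fix i j k l :: nat
    assume ij: "i < j" "j < 5" and kl: "k < l" "l < 5" and "(i, j) \<noteq> (k, l)"
    with less_five_cases[OF ij] less_five_cases[OF kl]
    show "\<exists>a b. p i j $ a * p k l $ b \<noteq> p i j $ b * p k l $ a"
      using t t1 by (elim insertE emptyE) (simp_all add: p_def exists_3)
  qed
qed

end
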